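(* Let $(X_n)_{n\in\mathbb{Z}}$ be a stationary Markov chain on a finite state space $\mathbb{S}$ with irreducible transition matrix $P=(P_{ij})_{i,j\in\mathbb{S}}$, ergodic with respect to its unique, strictly positive invariant distribution $\pi$, and let $P^-=(P^-_{ij})_{i,j\in\mathbb{S}}$ be the transition matrix of the time-reversed process. Then for every $i\in C$, $$q_i^+=\sum_{\tau\in\mathbb{Z}^+}\ \sum_{\substack{i_1,\dots,i_{\tau-1}\in C\\ i_\tau\in B}}P_{ii_1}\cdots P_{i_{\tau-1}i_\tau},$$ and for every $i\in C$, $$q_i^-=\sum_{\tau\in\mathbb{Z}^-}\ \sum_{\substack{i_\tau\in A\\ i_{\tau+1},\dots,i_{-1}\in C}}P^-_{i_{\tau+1}i_\tau}\cdots P^-_{ii_{-1}}.$$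
   Context: $A,B\subset\mathbb{S}$ are non-empty disjoint subsets of the finite state space $\mathbb{S}$ with $C:=(A\cup B)^c$ non-empty. $\mathbb{Z}^+=\{1,2,\dots\}$, $\mathbb{Z}^-=\{-1,-2,\dots\}$. The chain is stationary: $\mathbb{P}(X_n=i)=\pi_i$ for all $n$, with $\pi^\top=\pi^\top P$. $P^-_{ij}:=\mathbb{P}(X_{n-1}=j\mid X_n=i)=\pi_jP_{ji}/\pi_i$. For $S\subset\mathbb{S}$ and $n\in\mathbb{Z}$: $\tau_S^+(n):=\inf\{k\in\mathbb{Z}: k\ge n, X_k\in S\}$ ($\inf\emptyset:=\infty$), $\tau_S^-(n):=\sup\{k\in\mathbb{Z}: k\le n, X_k\in S\}$ ($\sup\emptyset:=-\infty$). The forward and backward committors are $q_i^+:=\mathbb{P}(\tau_B^+(n)<\tau_A^+(n)\mid X_n=i)$ and $q_i^-:=\mathbb{P}(\tau_A^-(n)>\tau_B^-(n)\mid X_n=i)$; by stationarity they do not depend on $n$. In the sums, the term for $\tau=1$ is $\sum_{i_1\in B}P_{ii_1}$ and the term for $\tau=-1$ is $\sum_{i_{-1}\in A}P^-_{ii_{-1}}$. *)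

theory Defs
  imports "HOL-Probability.Probability"
begin

text \<open>
  The finite state space is a type of class \<open>finite\<close>; transition matrices are elements of
  \<open>real ^ 's ^ 's\<close> with \<open>P $ i $ j\<close> the probability of moving from \<open>i\<close> to \<open>j\<close>.
\<close>

definition stochastic_matrix :: "real ^ 's ^ 's::finite \<Rightarrow> bool" where
  "stochastic_matrix P \<longleftrightarrow> (\<forall>i j. 0 \<le> P $ i $ j) \<and> (\<forall>i. (\<Sum>j\<in>UNIV. P $ i $ j) = 1)"

text \<open>
  Matrix powers are written by iterating \<open>(**)\<close>, because multiplication on \<open>real ^ 's ^ 's\<close>,
  and hence \<open>^\<close>, is componentwise.
\<close>

definition irreducible_matrix :: "real ^ 's ^ 's::finite \<Rightarrow> bool" where
  "irreducible_matrix P \<longleftrightarrow> (\<forall>i j. \<exists>n::nat. ((((**) P) ^^ n) (mat 1)) $ i $ j > 0)"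

definition invariant_distribution :: "real ^ 's ^ 's::finite \<Rightarrow> real ^ 's \<Rightarrow> bool" where
  "invariant_distribution P \<pi> \<longleftrightarrow>
     (\<forall>i. 0 \<le> \<pi> $ i) \<and> (\<Sum>i\<in>UNIV. \<pi> $ i) = 1 \<and> \<pi> v* P = \<pi>"

text \<open>
  A two-sided, time-homogeneous Markov chain. The past is a finite history over the times
  \<open>m, \<dots>, n\<close>, and only histories of positive probability are conditioned on.
\<close>

definition markov_chain ::
    "'w measure \<Rightarrow> (int \<Rightarrow> 'w \<Rightarrow> 's::finite) \<Rightarrow> real ^ 's ^ 's \<Rightarrow> bool" where
  "markov_chain M X P \<longleftrightarrow>
     prob_space M \<and>
     (\<forall>n. X n \<in> measurable M (count_space UNIV)) \<and>
     stochastic_matrix P \<and>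
     (\<forall>m n x j. m \<le> n \<longrightarrow> \<P>(\<omega> in M. \<forall>k\<in>{m..n}. X k \<omega> = x k) > 0 \<longrightarrow>
        \<P>(\<omega> in M. X (n + 1) \<omega> = j \<bar> \<forall>k\<in>{m..n}. X k \<omega> = x k) = P $ x n $ j)"

definition stationary_with ::
    "'w measure \<Rightarrow> (int \<Rightarrow> 'w \<Rightarrow> 's::finite) \<Rightarrow> real ^ 's \<Rightarrow> bool" where
  "stationary_with M X \<pi> \<longleftrightarrow> (\<forall>n i. \<P>(\<omega> in M. X n \<omega> = i) = \<pi> $ i)"

text \<open>Every shift-invariant event of the path space has probability 0 or 1.\<close>

definition ergodic_process :: "'w measure \<Rightarrow> (int \<Rightarrow> 'w \<Rightarrow> 's::finite) \<Rightarrow> bool" where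
  "ergodic_process M X \<longleftrightarrow>
     (\<forall>E \<in> sets (Pi\<^sub>M (UNIV :: int set) (\<lambda>_. count_space (UNIV :: 's set))).
        (\<lambda>x k. x (k + 1)) -` E = E \<longrightarrow>
        \<P>(\<omega> in M. (\<lambda>k. X k \<omega>) \<in> E) \<in> {0, 1})"

text \<open>
  The transition matrix of the time-reversed process, read off at time \<open>n\<close>. For a stationary
  chain it does not depend on \<open>n\<close> and its entries are \<open>\<pi> $ j * P $ j $ i / \<pi> $ i\<close>.
\<close>

definition backward_transition ::
    "'w measure \<Rightarrow> (int \<Rightarrow> 'w \<Rightarrow> 's::finite) \<Rightarrow> int \<Rightarrow> real ^ 's ^ 's" where
  "backward_transition M X n = (\<chi> i j. \<P>(\<omega> in M. X (n - 1) \<omega> = j \<bar> X n \<omega> = i))"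

text \<open>
  First entrance and last exit times take values in \<open>ereal\<close>, where \<open>Inf {} = \<infinity>\<close> and
  \<open>Sup {} = -\<infinity>\<close>.
\<close>

definition first_entrance :: "(int \<Rightarrow> 'w \<Rightarrow> 's) \<Rightarrow> 's set \<Rightarrow> int \<Rightarrow> 'w \<Rightarrow> ereal" where
  "first_entrance X S n \<omega> = (INF k\<in>{k. n \<le> k \<and> X k \<omega> \<in> S}. ereal (of_int k))"

definition last_exit :: "(int \<Rightarrow> 'w \<Rightarrow> 's) \<Rightarrow> 's set \<Rightarrow> int \<Rightarrow> 'w \<Rightarrow> ereal" where
  "last_exit X S n \<omega> = (SUP k\<in>{k. k \<le> n \<and> X k \<omega> \<in> S}. ereal (of_int k))"

definition forward_committor ::
    "'w measure \<Rightarrow> (int \<Rightarrow> 'w \<Rightarrow> 's) \<Rightarrow> 's set \<Rightarrow> 's set \<Rightarrow> int \<Rightarrow> 's \<Rightarrow> real" where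
  "forward_committor M X A B n i =
     \<P>(\<omega> in M. first_entrance X B n \<omega> < first_entrance X A n \<omega> \<bar> X n \<omega> = i)"

definition backward_committor ::
    "'w measure \<Rightarrow> (int \<Rightarrow> 'w \<Rightarrow> 's) \<Rightarrow> 's set \<Rightarrow> 's set \<Rightarrow> int \<Rightarrow> 's \<Rightarrow> real" where
  "backward_committor M X A B n i =
     \<P>(\<omega> in M. last_exit X A n \<omega> > last_exit X B n \<omega> \<bar> X n \<omega> = i)"

text \<open>
  The two path sums for a fixed \<open>\<tau>\<close>. A tuple of states is an extensional function on the integer
  interval of its indices, and the starting state \<open>i\<close> is put at index \<open>0\<close>.
\<close>

definition forward_path_sum ::
    "real ^ 's ^ 's \<Rightarrow> 's::finite set \<Rightarrow> 's set \<Rightarrow> 's \<Rightarrow> int \<Rightarrow> real" where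
  "forward_path_sum P C B i \<tau> =
     (\<Sum>x \<in> (\<Pi>\<^sub>E k\<in>{1..\<tau>}. if k = \<tau> then B else C).
        let y = x(0 := i) in \<Prod>k\<in>{1..\<tau>}. P $ y (k - 1) $ y k)"

definition backward_path_sum ::
    "real ^ 's ^ 's \<Rightarrow> 's::finite set \<Rightarrow> 's set \<Rightarrow> 's \<Rightarrow> int \<Rightarrow> real" where
  "backward_path_sum Q C A i \<tau> =
     (\<Sum>x \<in> (\<Pi>\<^sub>E k\<in>{\<tau>..-1}. if k = \<tau> then A else C).
        let y = x(0 := i) in \<Prod>k\<in>{\<tau>..-1}. Q $ y (k + 1) $ y k)"

end

theory Submission
  imports Defs
begin

text \<open>
  Starting in \<open>C\<close>, the process hits \<open>B\<close> before \<open>A\<close> exactly if for some \<open>\<tau> \<ge> 1\<close> it stays in \<open>C\<close> for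
  \<open>\<tau> - 1\<close> steps and is in \<open>B\<close> at step \<open>\<tau>\<close>. These events are disjoint for different \<open>\<tau>\<close>, and the
  event for a given \<open>\<tau>\<close> is a finite disjoint union of cylinder events, whose probabilities are
  \<open>\<pi> $ i\<close> times the products in the path sum. Countable additivity then gives the forward formula
  (\<open>forward_committor_has_sum\<close>).

  This argument is phrased in terms of the finite-dimensional distributions (\<open>has_path_law\<close>), so
  that it applies to both time directions. The reversed process \<open>\<lambda>k. X (- k)\<close> has distributions of the same form, with
  transition matrix \<open>Q = backward_transition M X m\<close>, because the flow identity
  \<open>\<pi> $ i * Q $ i $ j = \<pi> $ j * P $ j $ i\<close> moves the initial weight from one end of a path to the
  other (\<open>has_path_law_reverse\<close>). Since the last exit times of \<open>X\<close> are the negated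
  first entrance times of the reversed process, the backward formula is the forward formula for the
  reversed process with \<open>A\<close> and \<open>B\<close> exchanged.
\<close>

section \<open>Finite-dimensional distributions\<close>

definition has_path_law ::
    "'w measure \<Rightarrow> (int \<Rightarrow> 'w \<Rightarrow> 's::finite) \<Rightarrow> real ^ 's ^ 's \<Rightarrow> real ^ 's \<Rightarrow> bool" where
  "has_path_law M X P \<pi> \<longleftrightarrow>
     (\<forall>m n x. m \<le> n \<longrightarrow>
        \<P>(\<omega> in M. \<forall>k\<in>{m..n}. X k \<omega> = x k) = \<pi> $ x m * (\<Prod>k\<in>{m+1..n}. P $ x (k - 1) $ x k))"

lemma has_path_lawD:
  assumes "has_path_law M X P \<pi>" "m \<le> n"
  shows "\<P>(\<omega> in M. \<forall>k\<in>{m..n}. X k \<omega> = x k) = \<pi> $ x m * (\<Prod>k\<in>{m+1..n}. P $ x (k - 1) $ x k)"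
  using assms by (simp add: has_path_law_def)

text \<open>
  The chain rule for conditional probabilities, by induction on the length of the history. A
  history of probability zero has to be treated apart, since nothing is known about the transitions
  out of it; then both sides vanish.
\<close>

lemma markov_chain_has_path_law:
  fixes X :: "int \<Rightarrow> 'w \<Rightarrow> 's::finite"
  assumes mc: "markov_chain M X P" and st: "stationary_with M X \<pi>"
  shows "has_path_law M X P \<pi>"
  unfolding has_path_law_def
proof (intro allI impI)
  fix m n :: int and x :: "int \<Rightarrow> 's"
  interpret prob_space M using mc by (simp add: markov_chain_def)
  have X [measurable]: "X k \<in> measurable M (count_space UNIV)" for k
    using mc by (simp add: markov_chain_def)
  let ?H = "\<lambda>n. {\<omega> \<in> space M. \<forall>k\<in>{m..n}. X k \<omega> = x k}"
  assume "m \<le> n"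
  then show "prob (?H n) = \<pi> $ x m * (\<Prod>k\<in>{m+1..n}. P $ x (k - 1) $ x k)"
  proof (induction n rule: int_ge_induct)
    case base
    then show ?case using st by (simp add: stationary_with_def)
  next
    case (step n)
    have "{m..n + 1} = insert (n + 1) {m..n}" using step.hyps by auto
    then have H: "?H (n + 1) = {\<omega> \<in> space M. X (n + 1) \<omega> = x (n + 1) \<and> (\<forall>k\<in>{m..n}. X k \<omega> = x k)}"
      by auto
    have next_step: "prob (?H (n + 1)) = prob (?H n) * P $ x n $ x (n + 1)"
    proof (cases "prob (?H n) > 0")
      case True
      then have "\<P>(\<omega> in M. X (n + 1) \<omega> = x (n + 1) \<bar> \<forall>k\<in>{m..n}. X k \<omega> = x k) = P $ x n $ x (n + 1)"
        using mc step.hyps by (simp add: markov_chain_def)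
      then show ?thesis unfolding H using True by (simp add: cond_prob_def field_simps)
    next
      case False
      then have "prob (?H n) = 0" using measure_nonneg[of M "?H n"] by linarith
      moreover have "prob (?H (n + 1)) \<le> prob (?H n)"
        by (rule finite_measure_mono) auto
      ultimately show ?thesis using measure_nonneg[of M "?H (n + 1)"] by simp
    qed
    have "{m+1..n + 1} = insert (n + 1) {m+1..n}" using step.hyps by auto
    then show ?case using next_step step.IH by (simp add: ac_simps)
  qed
qed

lemma backward_transition_flow:
  fixes X :: "int \<Rightarrow> 'w \<Rightarrow> 's::finite"
  assumes law: "has_path_law M X P \<pi>" and pos: "\<pi> $ i > 0"
  shows "\<pi> $ i * backward_transition M X m $ i $ j = \<pi> $ j * P $ j $ i"
proof -
  let ?x = "\<lambda>k. if k = m then i else j"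
  have "{m - 1..m} = {m - 1, m}" by auto
  then have "\<P>(\<omega> in M. X (m - 1) \<omega> = j \<and> X m \<omega> = i) = \<pi> $ j * P $ j $ i"
    using has_path_lawD[OF law, of "m - 1" m ?x] by simp
  moreover have "\<P>(\<omega> in M. X m \<omega> = i) = \<pi> $ i"
    using has_path_lawD[OF law, of m m "\<lambda>_. i"] by simp
  ultimately show ?thesis
    using pos by (simp add: backward_transition_def cond_prob_def)
qed

text \<open>
  Along a reversed path, each factor \<open>\<pi> $ i * Q $ i $ j\<close> is exchanged for \<open>\<pi> $ j * P $ j $ i\<close> in
  turn, so the weight travels from the beginning of the path to its end.
\<close>

lemma path_weight_reverse:
  fixes P Q :: "real ^ 's ^ 's::finite" and x :: "int \<Rightarrow> 's"
  assumes flow: "\<And>i j. \<pi> $ i * Q $ i $ j = \<pi> $ j * P $ j $ i" and "m \<le> n"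
  shows "\<pi> $ x m * (\<Prod>k\<in>{m+1..n}. Q $ x (k - 1) $ x k) =
         \<pi> $ x n * (\<Prod>k\<in>{m+1..n}. P $ x k $ x (k - 1))"
  using \<open>m \<le> n\<close>
proof (induction n rule: int_ge_induct)
  case base
  then show ?case by simp
next
  case (step n)
  have ins: "{m+1..n + 1} = insert (n + 1) {m+1..n}" using step.hyps by auto
  have "\<pi> $ x m * (\<Prod>k\<in>{m+1..n+1}. Q $ x (k - 1) $ x k)
      = (\<pi> $ x m * (\<Prod>k\<in>{m+1..n}. Q $ x (k - 1) $ x k)) * Q $ x n $ x (n + 1)"
    by (simp add: ins)
  also have "\<dots> = (\<pi> $ x n * Q $ x n $ x (n + 1)) * (\<Prod>k\<in>{m+1..n}. P $ x k $ x (k - 1))"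
    by (simp add: step.IH)
  also have "\<dots> = \<pi> $ x (n + 1) * (\<Prod>k\<in>{m+1..n+1}. P $ x k $ x (k - 1))"
    by (simp add: flow ins)
  finally show ?case .
qed

lemma has_path_law_reverse:
  fixes P Q :: "real ^ 's ^ 's::finite" and X :: "int \<Rightarrow> 'w \<Rightarrow> 's"
  assumes law: "has_path_law M X P \<pi>"
    and flow: "\<And>i j. \<pi> $ i * Q $ i $ j = \<pi> $ j * P $ j $ i"
  shows "has_path_law M (\<lambda>k. X (- k)) Q \<pi>"
  unfolding has_path_law_def
proof (intro allI impI)
  fix m n :: int and x :: "int \<Rightarrow> 's"
  assume "m \<le> n"
  have "(\<forall>k\<in>{m..n}. X (- k) \<omega> = x k) \<longleftrightarrow> (\<forall>k\<in>{- n..- m}. X k \<omega> = x (- k))" for \<omega>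
    by (metis atLeastAtMost_iff minus_minus neg_le_iff_le)
  then have "\<P>(\<omega> in M. \<forall>k\<in>{m..n}. X (- k) \<omega> = x k)
      = \<pi> $ x n * (\<Prod>k\<in>{- n + 1..- m}. P $ x (1 - k) $ x (- k))"
    using has_path_lawD[OF law, of "- n" "- m" "\<lambda>k. x (- k)"] \<open>m \<le> n\<close> by simp
  also have "(\<Prod>k\<in>{- n + 1..- m}. P $ x (1 - k) $ x (- k))
      = (\<Prod>k\<in>{m+1..n}. P $ x k $ x (k - 1))"
    by (rule prod.reindex_bij_witness[of _ "\<lambda>k. 1 - k" "\<lambda>k. 1 - k"]) auto
  also have "\<pi> $ x n * \<dots> = \<pi> $ x m * (\<Prod>k\<in>{m+1..n}. Q $ x (k - 1) $ x k)"
    using path_weight_reverse[OF flow \<open>m \<le> n\<close>] by simp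
  finally show "\<P>(\<omega> in M. \<forall>k\<in>{m..n}. X (- k) \<omega> = x k)
      = \<pi> $ x m * (\<Prod>k\<in>{m+1..n}. Q $ x (k - 1) $ x k)" .
qed

text \<open>
  A tuple \<open>x\<close> stands for the cylinder event that the process, shifted to start at time \<open>n\<close>,
  follows \<open>x(0 := i)\<close>. Extensionality of the tuples makes these events disjoint.
\<close>

lemma prob_path_in_sets:
  fixes X :: "int \<Rightarrow> 'w \<Rightarrow> 's::finite" and S :: "int \<Rightarrow> 's set"
  assumes "prob_space M" and X [measurable]: "\<And>k. X k \<in> measurable M (count_space UNIV)"
    and law: "has_path_law M X P \<pi>" and "0 \<le> t"
  shows "\<P>(\<omega> in M. X n \<omega> = i \<and> (\<forall>k\<in>{1..t}. X (n + k) \<omega> \<in> S k)) =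
    \<pi> $ i * (\<Sum>x\<in>(\<Pi>\<^sub>E k\<in>{1..t}. S k). let y = x(0 := i) in \<Prod>k\<in>{1..t}. P $ y (k - 1) $ y k)"
proof -
  interpret prob_space M by fact
  let ?I = "\<Pi>\<^sub>E k\<in>{1..t}. S k"
  let ?Z = "\<lambda>x. {\<omega> \<in> space M. \<forall>k\<in>{n..n + t}. X k \<omega> = (x(0 := i)) (k - n)}"
  have cyl: "?Z x = {\<omega> \<in> space M. X n \<omega> = i \<and> (\<forall>k\<in>{1..t}. X (n + k) \<omega> = x k)}" for x
  proof -
    have "(\<forall>k\<in>{n..n + t}. X k \<omega> = (x(0 := i)) (k - n))
        \<longleftrightarrow> X n \<omega> = i \<and> (\<forall>k\<in>{1..t}. X (n + k) \<omega> = x k)" (is "?L \<longleftrightarrow> ?R") for \<omega>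
    proof
      assume L: ?L
      have "X (n + k) \<omega> = x k" if "k \<in> {1..t}" for k
        using L[rule_format, of "n + k"] that by simp
      then show ?R using L[rule_format, of n] \<open>0 \<le> t\<close> by simp
    next
      assume R: ?R
      show ?L
      proof
        fix k assume "k \<in> {n..n + t}"
        then show "X k \<omega> = (x(0 := i)) (k - n)"
          using R[THEN conjunct1] R[THEN conjunct2, rule_format, of "k - n"]
          by (cases "k = n") auto
      qed
    qed
    then show ?thesis by simp
  qed
  have "{\<omega> \<in> space M. X n \<omega> = i \<and> (\<forall>k\<in>{1..t}. X (n + k) \<omega> \<in> S k)} = (\<Union>x\<in>?I. ?Z x)"
  proof (intro equalityI subsetI)
    fix \<omega> assume \<omega>: "\<omega> \<in> {\<omega> \<in> space M. X n \<omega> = i \<and> (\<forall>k\<in>{1..t}. X (n + k) \<omega> \<in> S k)}"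
    then have "restrict (\<lambda>k. X (n + k) \<omega>) {1..t} \<in> ?I" by auto
    moreover have "\<omega> \<in> ?Z (restrict (\<lambda>k. X (n + k) \<omega>) {1..t})"
      unfolding cyl using \<omega> by simp
    ultimately show "\<omega> \<in> (\<Union>x\<in>?I. ?Z x)" by blast
  next
    fix \<omega> assume "\<omega> \<in> (\<Union>x\<in>?I. ?Z x)"
    then show "\<omega> \<in> {\<omega> \<in> space M. X n \<omega> = i \<and> (\<forall>k\<in>{1..t}. X (n + k) \<omega> \<in> S k)}"
      unfolding cyl by (auto simp: PiE_iff)
  qed
  moreover have "prob (\<Union>x\<in>?I. ?Z x) = (\<Sum>x\<in>?I. prob (?Z x))"
  proof (rule finite_measure_finite_Union)
    show "finite ?I" by (intro finite_PiE) auto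
    show "?Z ` ?I \<subseteq> sets M" by auto
    show "disjoint_family_on ?Z ?I"
      unfolding disjoint_family_on_def
    proof (intro ballI impI equals0I)
      fix x x' \<omega> assume "x \<in> ?I" "x' \<in> ?I" "x \<noteq> x'" and "\<omega> \<in> ?Z x \<inter> ?Z x'"
      then have "\<forall>k\<in>{1..t}. x k = x' k" unfolding cyl by auto
      with \<open>x \<in> ?I\<close> \<open>x' \<in> ?I\<close> have "x = x'" by (intro PiE_ext) auto
      with \<open>x \<noteq> x'\<close> show False by simp
    qed
  qed
  moreover have "prob (?Z x)
      = \<pi> $ i * (let y = x(0 := i) in \<Prod>k\<in>{1..t}. P $ y (k - 1) $ y k)" for x
  proof -
    define y where "y = x(0 := i)"
    have "prob (?Z x) = \<pi> $ y 0 * (\<Prod>k\<in>{n+1..n+t}. P $ y (k - 1 - n) $ y (k - n))"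
      using has_path_lawD[OF law, of n "n + t" "\<lambda>k. y (k - n)"] \<open>0 \<le> t\<close>
      unfolding y_def by simp
    also have "(\<Prod>k\<in>{n+1..n+t}. P $ y (k - 1 - n) $ y (k - n)) = (\<Prod>k\<in>{1..t}. P $ y (k - 1) $ y k)"
      by (rule prod.reindex_bij_witness[of _ "\<lambda>k. k + n" "\<lambda>k. k - n"]) (auto simp: algebra_simps)
    finally show ?thesis by (simp add: y_def Let_def)
  qed
  ultimately show ?thesis by (simp add: sum_distrib_left)
qed

section \<open>The forward committor\<close>

lemma first_entrance_less_iff:
  "first_entrance X B n \<omega> < first_entrance X A n \<omega> \<longleftrightarrow>
     (\<exists>k\<ge>n. X k \<omega> \<in> B \<and> (\<forall>j\<in>{n..k}. X j \<omega> \<notin> A))"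
proof
  assume "first_entrance X B n \<omega> < first_entrance X A n \<omega>"
  then obtain k where k: "n \<le> k" "X k \<omega> \<in> B" "ereal (of_int k) < first_entrance X A n \<omega>"
    unfolding first_entrance_def[of X B] INF_less_iff by auto
  have "X j \<omega> \<notin> A" if "j \<in> {n..k}" for j
  proof
    assume "X j \<omega> \<in> A"
    with that have "first_entrance X A n \<omega> \<le> ereal (of_int j)"
      unfolding first_entrance_def by (intro INF_lower) auto
    also have "\<dots> \<le> ereal (of_int k)" using that by simp
    finally show False using k(3) by simp
  qed
  with k show "\<exists>k\<ge>n. X k \<omega> \<in> B \<and> (\<forall>j\<in>{n..k}. X j \<omega> \<notin> A)" by blast
next
  assume "\<exists>k\<ge>n. X k \<omega> \<in> B \<and> (\<forall>j\<in>{n..k}. X j \<omega> \<notin> A)"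
  then obtain k where k: "n \<le> k" "X k \<omega> \<in> B" "\<forall>j\<in>{n..k}. X j \<omega> \<notin> A" by blast
  have "first_entrance X B n \<omega> \<le> ereal (of_int k)"
    unfolding first_entrance_def using k by (intro INF_lower) auto
  also have "\<dots> < ereal (of_int (k + 1))" by simp
  also have "\<dots> \<le> first_entrance X A n \<omega>"
    unfolding first_entrance_def
  proof (rule INF_greatest)
    fix j assume "j \<in> {k. n \<le> k \<and> X k \<omega> \<in> A}"
    with k(3) have "k + 1 \<le> j" by force
    then show "ereal (of_int (k + 1)) \<le> ereal (of_int j)" by (simp only: ereal_less_eq of_int_le_iff)
  qed
  finally show "first_entrance X B n \<omega> < first_entrance X A n \<omega>" .
qed

text \<open>The witness for \<open>\<tau>\<close> is the first hitting time of \<open>B\<close>, counted from \<open>n\<close>.\<close>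

lemma first_entrance_less_iff_path:
  fixes X :: "int \<Rightarrow> 'w \<Rightarrow> 's"
  assumes "A \<inter> B = {}" "C = - (A \<union> B)" "X n \<omega> \<in> C"
  shows "first_entrance X B n \<omega> < first_entrance X A n \<omega> \<longleftrightarrow>
    (\<exists>\<tau>\<ge>1. \<forall>k\<in>{1..\<tau>}. X (n + k) \<omega> \<in> (if k = \<tau> then B else C))"
  unfolding first_entrance_less_iff
proof
  assume "\<exists>k\<ge>n. X k \<omega> \<in> B \<and> (\<forall>j\<in>{n..k}. X j \<omega> \<notin> A)"
  then obtain k where k: "n \<le> k" "X k \<omega> \<in> B" "\<forall>j\<in>{n..k}. X j \<omega> \<notin> A" by blast
  define l where "l = (LEAST l. X (n + int l) \<omega> \<in> B)"
  have hit: "X (n + int (nat (k - n))) \<omega> \<in> B" using k by simp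
  have l: "X (n + int l) \<omega> \<in> B" unfolding l_def by (rule LeastI[of "\<lambda>l. X (n + int l) \<omega> \<in> B", OF hit])
  have "l \<le> nat (k - n)" unfolding l_def by (rule Least_le[of "\<lambda>l. X (n + int l) \<omega> \<in> B", OF hit])
  then have lk: "n + int l \<le> k" using k(1) by linarith
  have "l \<noteq> 0" using l assms by (metis ComplD UnCI add.right_neutral of_nat_0)
  have "X (n + j) \<omega> \<in> C" if "1 \<le> j" "j < int l" for j
  proof -
    have "X (n + int (nat j)) \<omega> \<notin> B"
      by (rule not_less_Least) (use that in \<open>simp add: l_def[symmetric]; linarith\<close>)
    moreover have "X (n + j) \<omega> \<notin> A" using k(3) lk that by simp
    ultimately show ?thesis using that assms(2) by simp
  qed
  with l \<open>l \<noteq> 0\<close> show "\<exists>\<tau>\<ge>1. \<forall>k\<in>{1..\<tau>}. X (n + k) \<omega> \<in> (if k = \<tau> then B else C)"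
    by (intro exI[of _ "int l"]) auto
next
  assume "\<exists>\<tau>\<ge>1. \<forall>k\<in>{1..\<tau>}. X (n + k) \<omega> \<in> (if k = \<tau> then B else C)"
  then obtain \<tau> where \<tau>: "\<tau> \<ge> 1" "\<forall>k\<in>{1..\<tau>}. X (n + k) \<omega> \<in> (if k = \<tau> then B else C)" by blast
  have "X j \<omega> \<notin> A" if "j \<in> {n..n + \<tau>}" for j
  proof (cases "j = n")
    case False
    then have "j - n \<in> {1..\<tau>}" using that by auto
    from \<tau>(2)[rule_format, OF this] show ?thesis
      using assms(1,2) by (auto split: if_splits)
  qed (use assms in auto)
  then show "\<exists>k\<ge>n. X k \<omega> \<in> B \<and> (\<forall>j\<in>{n..k}. X j \<omega> \<notin> A)"
    using \<tau>(1) \<tau>(2)[rule_format, of \<tau>] by (intro exI[of _ "n + \<tau>"]) auto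
qed

lemma (in finite_measure) measure_UN_has_sum_int:
  fixes E :: "int \<Rightarrow> 'a set"
  assumes E: "\<And>\<tau>. E \<tau> \<in> sets M" and disj: "disjoint_family_on E {1..}"
  shows "((\<lambda>\<tau>. measure M (E \<tau>)) has_sum measure M (\<Union>\<tau>\<in>{1..}. E \<tau>)) {1..}"
proof -
  have bij: "bij_betw (\<lambda>l. 1 + int l) UNIV {1..}"
    by (rule bij_betwI[where g = "\<lambda>\<tau>. nat (\<tau> - 1)"]) auto
  then have "(\<Union>l. E (1 + int l)) = (\<Union>\<tau>\<in>{1..}. E \<tau>)"
    by (metis bij_betw_imp_surj_on image_image)
  moreover have "(\<lambda>l. measure M (E (1 + int l))) sums measure M (\<Union>l. E (1 + int l))"
    by (rule finite_measure_UNION) (use E disj in \<open>auto simp: disjoint_family_on_def\<close>)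
  ultimately have "((\<lambda>l. measure M (E (1 + int l))) has_sum measure M (\<Union>\<tau>\<in>{1..}. E \<tau>)) UNIV"
    by (simp add: sums_nonneg_imp_has_sum)
  then show ?thesis using has_sum_reindex_bij_betw[OF bij] by fastforce
qed

lemma forward_committor_has_sum:
  fixes X :: "int \<Rightarrow> 'w \<Rightarrow> 's::finite"
  assumes "prob_space M" and X [measurable]: "\<And>k. X k \<in> measurable M (count_space UNIV)"
    and law: "has_path_law M X P \<pi>" and pos: "\<pi> $ i > 0"
    and AB: "A \<inter> B = {}" "C = - (A \<union> B)" and "i \<in> C"
  shows "(forward_path_sum P C B i has_sum forward_committor M X A B n i) {1..}"
proof -
  interpret prob_space M by fact
  let ?E = "\<lambda>\<tau>. {\<omega> \<in> space M. X n \<omega> = i \<and> (\<forall>k\<in>{1..\<tau>}. X (n + k) \<omega> \<in> (if k = \<tau> then B else C))}"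
  have "disjoint_family_on ?E {1..}"
    unfolding disjoint_family_on_def
  proof (intro ballI impI)
    have disj: "?E \<sigma> \<inter> ?E \<tau> = {}" if "1 \<le> \<sigma>" "\<sigma> < \<tau>" for \<sigma> \<tau>
    proof (intro equals0I)
      fix \<omega> assume "\<omega> \<in> ?E \<sigma> \<inter> ?E \<tau>"
      then have "X (n + \<sigma>) \<omega> \<in> B" "X (n + \<sigma>) \<omega> \<in> C" using that by force+
      then show False using AB by blast
    qed
    fix \<sigma> \<tau> :: int assume "\<sigma> \<in> {1..}" "\<tau> \<in> {1..}" "\<sigma> \<noteq> \<tau>"
    then show "?E \<sigma> \<inter> ?E \<tau> = {}"
      using disj[of \<sigma> \<tau>] disj[of \<tau> \<sigma>] by (cases "\<sigma> < \<tau>") (simp_all add: Int_commute)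
  qed
  then have add: "((\<lambda>\<tau>. prob (?E \<tau>)) has_sum prob (\<Union>\<tau>\<in>{1..}. ?E \<tau>)) {1..}"
    by (intro measure_UN_has_sum_int) measurable
  have hit: "(\<Union>\<tau>\<in>{1..}. ?E \<tau>)
      = {\<omega> \<in> space M. first_entrance X B n \<omega> < first_entrance X A n \<omega> \<and> X n \<omega> = i}"
  proof -
    have "first_entrance X B n \<omega> < first_entrance X A n \<omega> \<longleftrightarrow>
        (\<exists>\<tau>\<in>{1..}. \<forall>k\<in>{1..\<tau>}. X (n + k) \<omega> \<in> (if k = \<tau> then B else C))" if "X n \<omega> = i" for \<omega>
      using first_entrance_less_iff_path[OF AB, of X n \<omega>] \<open>i \<in> C\<close> that
      unfolding Bex_def atLeast_iff by metis
    then show ?thesis by blast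
  qed
  have path: "prob (?E \<tau>) = \<pi> $ i * forward_path_sum P C B i \<tau>" if "\<tau> \<in> {1..}" for \<tau>
    using prob_path_in_sets[OF \<open>prob_space M\<close> X law, of \<tau> n i "\<lambda>k. if k = \<tau> then B else C"] that
    by (simp add: forward_path_sum_def)
  have "prob {\<omega> \<in> space M. X n \<omega> = i} = \<pi> $ i"
    using has_path_lawD[OF law, of n n "\<lambda>_. i"] by simp
  then have "prob (\<Union>\<tau>\<in>{1..}. ?E \<tau>) = \<pi> $ i * forward_committor M X A B n i"
    unfolding hit using pos by (simp add: forward_committor_def cond_prob_def)
  moreover have "((\<lambda>\<tau>. prob (?E \<tau>)) has_sum s) {1..}
      \<longleftrightarrow> ((\<lambda>\<tau>. \<pi> $ i * forward_path_sum P C B i \<tau>) has_sum s) {1..}" for s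
    by (rule has_sum_cong) (rule path)
  ultimately have "((\<lambda>\<tau>. \<pi> $ i * forward_path_sum P C B i \<tau>)
      has_sum \<pi> $ i * forward_committor M X A B n i) {1..}"
    using add by simp
  then show ?thesis using pos by (simp add: has_sum_cmult_right_iff)
qed

section \<open>Time reversal\<close>

lemma last_exit_eq_first_entrance:
  "last_exit X S n \<omega> = - first_entrance (\<lambda>k. X (- k)) S (- n) \<omega>"
proof -
  have "{k. k \<le> n \<and> X k \<omega> \<in> S} = uminus ` {k. - n \<le> k \<and> X (- k) \<omega> \<in> S}"
    by (auto intro!: image_eqI[of _ uminus "- k" for k])
  then show ?thesis
    unfolding last_exit_def first_entrance_def
    by (simp add: image_image flip: ereal_SUP_uminus_eq)
qed

lemma backward_committor_eq_forward:
  "backward_committor M X A B n i = forward_committor M (\<lambda>k. X (- k)) B A (- n) i"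
  by (simp add: backward_committor_def forward_committor_def last_exit_eq_first_entrance)

lemma backward_path_sum_eq_forward:
  fixes Q :: "real ^ 's ^ 's::finite"
  shows "backward_path_sum Q C A i \<tau> = forward_path_sum Q C A i (- \<tau>)"
  unfolding backward_path_sum_def forward_path_sum_def
proof (rule sum.reindex_bij_witness[of _ "\<lambda>x k. x (- k)" "\<lambda>x k. x (- k)"])
  fix x assume x: "x \<in> (\<Pi>\<^sub>E k\<in>{\<tau>..-1}. if k = \<tau> then A else C)"
  show "(\<lambda>k. x (- k)) \<in> (\<Pi>\<^sub>E k\<in>{1..-\<tau>}. if k = - \<tau> then A else C)"
  proof (rule PiE_I)
    fix k assume "k \<in> {1..-\<tau>}"
    then show "x (- k) \<in> (if k = - \<tau> then A else C)"
      using PiE_mem[OF x, of "- k"] by (auto split: if_splits)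
  next
    fix k assume "k \<notin> {1..-\<tau>}"
    then show "x (- k) = undefined" by (intro PiE_arb[OF x]) auto
  qed
next
  fix x assume x: "x \<in> (\<Pi>\<^sub>E k\<in>{1..-\<tau>}. if k = - \<tau> then A else C)"
  show "(\<lambda>k. x (- k)) \<in> (\<Pi>\<^sub>E k\<in>{\<tau>..-1}. if k = \<tau> then A else C)"
  proof (rule PiE_I)
    fix k assume "k \<in> {\<tau>..-1}"
    then show "x (- k) \<in> (if k = \<tau> then A else C)"
      using PiE_mem[OF x, of "- k"] by (auto split: if_splits)
  next
    fix k assume "k \<notin> {\<tau>..-1}"
    then show "x (- k) = undefined" by (intro PiE_arb[OF x]) auto
  qed
next
  fix x :: "int \<Rightarrow> 's"
  let ?y = "x(0 := i)"
  have "(\<lambda>k. x (- k))(0 := i) = (\<lambda>k. ?y (- k))" by auto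
  moreover have "(\<Prod>k\<in>{1..-\<tau>}. Q $ ?y (- (k - 1)) $ ?y (- k)) = (\<Prod>k\<in>{\<tau>..-1}. Q $ ?y (k + 1) $ ?y k)"
    by (rule prod.reindex_bij_witness[of _ uminus uminus]) (auto simp: algebra_simps)
  ultimately show "(let y = (\<lambda>k. x (- k))(0 := i) in \<Prod>k\<in>{1..-\<tau>}. Q $ y (k - 1) $ y k)
      = (let y = ?y in \<Prod>k\<in>{\<tau>..-1}. Q $ y (k + 1) $ y k)"
    by (simp only: Let_def)
qed auto

section \<open>Both committors as path sums\<close>

theorem lemma3p5:
  fixes M :: "'w measure"
    and X :: "int \<Rightarrow> 'w \<Rightarrow> 's::finite"
    and P :: "real ^ 's ^ 's"
    and \<pi> :: "real ^ 's"
    and A B C :: "'s set"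
    and n m :: int
  assumes "markov_chain M X P"
    and "irreducible_matrix P"
    and "invariant_distribution P \<pi>"
    and "\<And>\<mu>. invariant_distribution P \<mu> \<Longrightarrow> \<mu> = \<pi>"
    and "\<And>i. \<pi> $ i > 0"
    and "stationary_with M X \<pi>"
    and "ergodic_process M X"
    and "A \<noteq> {}" and "B \<noteq> {}" and "A \<inter> B = {}"
    and "C = - (A \<union> B)" and "C \<noteq> {}"
  shows "(\<forall>i\<in>C. (forward_path_sum P C B i has_sum forward_committor M X A B n i) {1..}) \<and>
         (\<forall>i\<in>C. (backward_path_sum (backward_transition M X m) C A i
                    has_sum backward_committor M X A B n i) {..-1})"
proof (intro conjI ballI)
  have M: "prob_space M" and X: "\<And>k. X k \<in> measurable M (count_space UNIV)"
    using assms(1) by (auto simp: markov_chain_def)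
  have law: "has_path_law M X P \<pi>"
    using assms(1,6) by (rule markov_chain_has_path_law)
  fix i assume i: "i \<in> C"
  show "(forward_path_sum P C B i has_sum forward_committor M X A B n i) {1..}"
    using assms(5,10,11) by (intro forward_committor_has_sum[OF M X law _ _ _ i])
  let ?Q = "backward_transition M X m"
  have rev: "has_path_law M (\<lambda>k. X (- k)) ?Q \<pi>"
    using law backward_transition_flow[OF law assms(5)] by (rule has_path_law_reverse)
  have "(forward_path_sum ?Q C A i has_sum backward_committor M X A B n i) {1..}"
    unfolding backward_committor_eq_forward
    by (intro forward_committor_has_sum[OF M X rev assms(5) _ _ i]) (use assms(10,11) in auto)
  moreover have "bij_betw uminus {..-1} {1::int..}"
    by (rule bij_betwI[where g = uminus]) auto
  ultimately show "(backward_path_sum ?Q C A i has_sum backward_committor M X A B n i) {..-1}"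
    using has_sum_reindex_bij_betw[of uminus "{..-1}" "{1::int..}" "forward_path_sum ?Q C A i"]
    by (simp add: backward_path_sum_eq_forward[abs_def])
qed

end
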